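(* Let $\mathbf{x}:U\to\mathbb{R}^3$ be a proper frontal with extendable normal curvature, and let $\mathbf{n}$ be the normal vector field induced by a tangent moving basis of $\mathbf{x}$. Then the Gaussian curvature and the mean curvature of $\mathbf{x}$ (defined on $\Sigma(\mathbf{x})^c$) have smooth extensions to $U$. Furthermore, this extension of the Gaussian curvature is non-vanishing on $U$ if and only if $\mathbf{x}\sim\mathbf{n}$.
   Context: All maps are $C^\infty$ and $U\subset\mathbb{R}^2$ is open. For $\mathbf{x}:U\to\mathbb{R}^3$, $D\mathbf{x}$ is the $3\times2$ Jacobian matrix. A tangent moving basis (tmb) of $\mathbf{x}$ is a smooth map $\mathbf{\Omega}=(\mathbf{w}_1\ \mathbf{w}_2):U\to\mathcal{M}_{3\times2}(\mathbb{R})$ with columns linearly independent at every point and $\mathbf{x}_u,\mathbf{x}_v\in\mathrm{span}(\mathbf{w}_1,\mathbf{w}_2)$. The map $\mathbf{x}$ is a frontal if near each point there is a smooth unit vector field orthogonal to $\mathbf{x}_u,\mathbf{x}_v$; equivalently, tmbs exist locally, and frontals are always assumed to have a global tmb. The normal field induced by $\mathbf{\Omega}$ is $\mathbf{n}=\frac{\mathbf{w}_1\times\mathbf{w}_2}{\|\mathbf{w}_1\times\mathbf{w}_2\|}$. $\Sigma(\mathbf{x})$ is the set of points where $\mathbf{x}$ is not immersive; the frontal is proper if $\Sigma(\mathbf{x})$ has empty interior. Set $\mathbf{I}=D\mathbf{x}^TD\mathbf{x}$, $\mathbf{II}=-D\mathbf{x}^TD\mathbf{n}$ and $\mathbf{\Lambda}_\Omega=D\mathbf{x}^T\mathbf{\Omega}(\mathbf{\Omega}^T\mathbf{\Omega})^{-1}$.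 The Gaussian and mean curvatures on $\Sigma(\mathbf{x})^c$ are $K=\det(\mathbf{II})/\det(\mathbf{I})$ and $H=\frac12\mathrm{tr}(\mathbf{II}\,\mathbf{I}^{-1})$. Normal curvature: at $p\in\Sigma(\mathbf{x})^c$, $k_p(\zeta)=\frac{\zeta^T\mathbf{II}\zeta}{\zeta^T\mathbf{I}\zeta}$ for $\zeta\in\mathbb{R}^2-\{0\}$. It is extendable if $(p,\omega)\mapsto k_p(\mathbf{\Lambda}_\Omega^{-T}\omega)$ on $\Sigma(\mathbf{x})^c\times(\mathbb{R}^2-\{0\})$ has a smooth extension to $U\times(\mathbb{R}^2-\{0\})$, where $\mathbf{\Omega}$ is a tmb of $\mathbf{x}$. For frontals $\mathbf{x}_1,\mathbf{x}_2$ on $U$, $\mathbf{x}_1\sim\mathbf{x}_2$ means that there exist tmbs $\mathbf{\Omega}_1,\mathbf{\Omega}_2$ of $\mathbf{x}_1,\mathbf{x}_2$ respectively and a smooth map $\mathbf{B}:U\to GL(2,\mathbb{R})$ with $\mathbf{\Lambda}_{\Omega_2}=\mathbf{\Lambda}_{\Omega_1}\mathbf{B}$, where $\mathbf{\Lambda}_{\Omega_i}=D\mathbf{x}_i^T\mathbf{\Omega}_i(\mathbf{\Omega}_i^T\mathbf{\Omega}_i)^{-1}$. The map $\mathbf{n}$ is itself regarded as a frontal $U\to\mathbb{R}^3$ (every tmb of $\mathbf{x}$ inducing $\mathbf{n}$ is also a tmb of $\mathbf{n}$). *)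

theory Defs
  imports "HOL-Analysis.Analysis"
begin

text \<open>
  Maps \<open>U \<rightarrow> V\<close> are total functions of which only the values on the open set \<open>U\<close> matter.
  A matrix with \<open>m\<close> rows and \<open>n\<close> columns has type \<^typ>\<open>real^'n^'m\<close>, so the \<open>3 \<times> 2\<close> matrices are
  those of type \<^typ>\<open>real^2^3\<close>.
\<close>

text \<open>
  \<open>Ck_on n S f\<close> is the class \<open>C\<^sup>n\<close> on \<open>S\<close>, expressed by directional derivatives; it is meant for
  open \<open>S\<close> and finite-dimensional domains only.
\<close>

primrec Ck_on :: "nat \<Rightarrow> 'a::euclidean_space set \<Rightarrow> ('a \<Rightarrow> 'b::real_normed_vector) \<Rightarrow> bool" where
  "Ck_on 0 S f \<longleftrightarrow> continuous_on S f"
| "Ck_on (Suc n) S f \<longleftrightarrow>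
     (\<forall>x\<in>S. f differentiable (at x)) \<and>
     (\<forall>v. Ck_on n S (\<lambda>x. frechet_derivative f (at x) v))"

definition smooth_on :: "'a::euclidean_space set \<Rightarrow> ('a \<Rightarrow> 'b::real_normed_vector) \<Rightarrow> bool" where
  "smooth_on S f \<longleftrightarrow> (\<forall>n. Ck_on n S f)"

abbreviation Jac :: "(real^2 \<Rightarrow> real^3) \<Rightarrow> real^2 \<Rightarrow> real^2^3" where
  "Jac f p \<equiv> jacobian f (at p)"

abbreviation deriv_u :: "(real^2 \<Rightarrow> real^3) \<Rightarrow> real^2 \<Rightarrow> real^3" where
  "deriv_u f p \<equiv> frechet_derivative f (at p) (axis 1 1)"

abbreviation deriv_v :: "(real^2 \<Rightarrow> real^3) \<Rightarrow> real^2 \<Rightarrow> real^3" where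
  "deriv_v f p \<equiv> frechet_derivative f (at p) (axis 2 1)"

definition tmb :: "(real^2) set \<Rightarrow> (real^2 \<Rightarrow> real^3) \<Rightarrow> (real^2 \<Rightarrow> real^2^3) \<Rightarrow> bool" where
  "tmb U f \<Omega> \<longleftrightarrow> smooth_on U \<Omega> \<and>
     (\<forall>p\<in>U. let w1 = column 1 (\<Omega> p); w2 = column 2 (\<Omega> p) in
        w1 \<noteq> w2 \<and> independent {w1, w2} \<and>
        deriv_u f p \<in> span {w1, w2} \<and> deriv_v f p \<in> span {w1, w2})"

text \<open>The last conjunct is the standing assumption that a frontal has a global tangent moving basis.\<close>

definition frontal :: "(real^2) set \<Rightarrow> (real^2 \<Rightarrow> real^3) \<Rightarrow> bool" where
  "frontal U f \<longleftrightarrow> smooth_on U f \<and>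
     (\<forall>p\<in>U. \<exists>V \<nu>. open V \<and> p \<in> V \<and> V \<subseteq> U \<and> smooth_on V (\<nu> :: real^2 \<Rightarrow> real^3) \<and>
        (\<forall>q\<in>V. norm (\<nu> q) = 1 \<and> orthogonal (\<nu> q) (deriv_u f q) \<and> orthogonal (\<nu> q) (deriv_v f q))) \<and>
     (\<exists>\<Omega>. tmb U f \<Omega>)"

definition singular_set :: "(real^2) set \<Rightarrow> (real^2 \<Rightarrow> real^3) \<Rightarrow> (real^2) set" where
  "singular_set U f = {p \<in> U. \<not> inj (frechet_derivative f (at p))}"

definition proper_frontal :: "(real^2) set \<Rightarrow> (real^2 \<Rightarrow> real^3) \<Rightarrow> bool" where
  "proper_frontal U f \<longleftrightarrow> frontal U f \<and> interior (singular_set U f) = {}"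

definition induced_normal :: "(real^2 \<Rightarrow> real^2^3) \<Rightarrow> real^2 \<Rightarrow> real^3" where
  "induced_normal \<Omega> p =
     (let w = cross3 (column 1 (\<Omega> p)) (column 2 (\<Omega> p)) in w /\<^sub>R norm w)"

definition form_I :: "(real^2 \<Rightarrow> real^3) \<Rightarrow> real^2 \<Rightarrow> real^2^2" where
  "form_I f p = transpose (Jac f p) ** Jac f p"

definition form_II :: "(real^2 \<Rightarrow> real^3) \<Rightarrow> (real^2 \<Rightarrow> real^3) \<Rightarrow> real^2 \<Rightarrow> real^2^2" where
  "form_II f n p = - (transpose (Jac f p) ** Jac n p)"

definition Lam :: "(real^2 \<Rightarrow> real^3) \<Rightarrow> (real^2 \<Rightarrow> real^2^3) \<Rightarrow> real^2 \<Rightarrow> real^2^2" where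
  "Lam f \<Omega> p = transpose (Jac f p) ** \<Omega> p ** matrix_inv (transpose (\<Omega> p) ** \<Omega> p)"

definition gauss_curvature :: "(real^2 \<Rightarrow> real^3) \<Rightarrow> (real^2 \<Rightarrow> real^3) \<Rightarrow> real^2 \<Rightarrow> real" where
  "gauss_curvature f n p = det (form_II f n p) / det (form_I f p)"

definition mean_curvature :: "(real^2 \<Rightarrow> real^3) \<Rightarrow> (real^2 \<Rightarrow> real^3) \<Rightarrow> real^2 \<Rightarrow> real" where
  "mean_curvature f n p = 1/2 * trace (form_II f n p ** matrix_inv (form_I f p))"

definition normal_curvature ::
    "(real^2 \<Rightarrow> real^3) \<Rightarrow> (real^2 \<Rightarrow> real^3) \<Rightarrow> real^2 \<Rightarrow> real^2 \<Rightarrow> real" where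
  "normal_curvature f n p \<zeta> = (\<zeta> \<bullet> (form_II f n p *v \<zeta>)) / (\<zeta> \<bullet> (form_I f p *v \<zeta>))"

text \<open>
  Two tangent moving bases of a proper frontal differ by a smooth invertible matrix field, so
  whether the extension exists does not depend on \<open>\<Omega>\<close>. The second fundamental form is taken with
  respect to the normal induced by the same \<open>\<Omega>\<close>; another choice changes it by a locally constant
  sign.
\<close>

definition extendable_normal_curvature :: "(real^2) set \<Rightarrow> (real^2 \<Rightarrow> real^3) \<Rightarrow> bool" where
  "extendable_normal_curvature U f \<longleftrightarrow>
     (\<exists>\<Omega>. tmb U f \<Omega> \<and>
       (\<exists>F :: (real^2) \<times> (real^2) \<Rightarrow> real.
          smooth_on (U \<times> (UNIV - {0})) F \<and>
          (\<forall>p \<in> U - singular_set U f. \<forall>\<omega>. \<omega> \<noteq> 0 \<longrightarrow>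
             F (p, \<omega>) = normal_curvature f (induced_normal \<Omega>) p
                          (transpose (matrix_inv (Lam f \<Omega> p)) *v \<omega>))))"

definition frontal_sim ::
    "(real^2) set \<Rightarrow> (real^2 \<Rightarrow> real^3) \<Rightarrow> (real^2 \<Rightarrow> real^3) \<Rightarrow> bool" where
  "frontal_sim U f g \<longleftrightarrow> frontal U f \<and> frontal U g \<and>
     (\<exists>\<Omega>1 \<Omega>2 (B :: real^2 \<Rightarrow> real^2^2).
        tmb U f \<Omega>1 \<and> tmb U g \<Omega>2 \<and> smooth_on U B \<and>
        (\<forall>p\<in>U. invertible (B p) \<and> Lam g \<Omega>2 p = Lam f \<Omega>1 p ** B p))"

definition smooth_extension :: "(real^2) set \<Rightarrow> (real^2) set \<Rightarrow> (real^2 \<Rightarrow> real) \<Rightarrow> (real^2 \<Rightarrow> real) \<Rightarrow> bool" where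
  "smooth_extension U R k k' \<longleftrightarrow> smooth_on U k' \<and> (\<forall>p\<in>R. k' p = k p)"

end

theory Submission
  imports Defs
begin

text \<open>
  Let \<open>V\<close> be a tangent moving basis of \<open>x\<close> orthogonal to the unit field \<open>n\<close>, write
  \<open>G = V\<^sup>T V\<close>, and let \<open>\<Lambda>\<close> be the matrix of \<open>x\<close> with respect to \<open>V\<close>, so that \<open>Dx = V \<Lambda>\<^sup>T\<close>. Where
  \<open>x\<close> is immersive \<open>\<Lambda>\<close> is invertible, and since the columns of \<open>Dn\<close> are orthogonal to \<open>n\<close> there is
  a unique matrix \<open>S\<close> with \<open>Dn = V S \<Lambda>\<^sup>T\<close>; up to sign it is the matrix of the shape operator in
  the basis \<open>V\<close>. Hence \<open>I = \<Lambda> G \<Lambda>\<^sup>T\<close> and \<open>II = - \<Lambda> G S \<Lambda>\<^sup>T\<close>, which gives \<open>K = det S\<close> and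
  \<open>H = - tr S / 2\<close>, while the normal curvature in the direction \<open>\<Lambda>\<^sup>-\<^sup>T \<omega>\<close> equals
  \<open>- (\<omega> \<bullet> G S \<omega>) / (\<omega> \<bullet> G \<omega>)\<close>.

  So a smooth extension of the normal curvature is a smooth extension of the quadratic form of
  \<open>G S\<close>. The matrix \<open>G S\<close> is symmetric because \<open>II\<close> is (\<open>form_II_symmetric\<close>, which rests on
  \<open>mixed_derivatives_commute\<close>), so polarization recovers all of its entries and \<open>S\<close> extends
  smoothly to \<open>U\<close>. As the singular set has empty interior, the identity \<open>Dn = V S \<Lambda>\<^sup>T\<close> survives on
  all of \<open>U\<close> by continuity; this is \<open>shape_matrix_extension\<close>. The basis for which the
  normal curvature is known to extend may induce a normal other than \<open>n\<close>, but the two normals differ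
  by a locally constant sign, which only changes the sign of \<open>S\<close> (\<open>shape_matrix_exists\<close>).
  The extensions of the curvatures are then \<open>det S\<close> and \<open>- tr S / 2\<close>.

  If \<open>det S\<close> does not vanish, transposing \<open>Dn = V S \<Lambda>\<^sup>T\<close> exhibits \<open>S\<^sup>T\<close> as the matrix field
  required by \<open>x \<sim> n\<close>. Conversely, let \<open>W1\<close> and \<open>W2\<close> be tangent moving bases of \<open>x\<close> and \<open>n\<close>
  whose matrices \<open>\<Lambda>1\<close> and \<open>\<Lambda>2\<close> satisfy \<open>\<Lambda>2 = \<Lambda>1 B\<close>, and denote by \<open>w1\<close> and \<open>w2\<close> the cross products of
  their columns. Then \<open>x\<^sub>u \<times> x\<^sub>v = det \<Lambda>1 w1\<close> and
  \<open>n\<^sub>u \<times> n\<^sub>v = det \<Lambda>1 det B w2\<close>, while \<open>n\<^sub>u \<times> n\<^sub>v = K (x\<^sub>u \<times> x\<^sub>v)\<close>. Cancelling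
  \<open>det \<Lambda>1\<close> where \<open>x\<close> is immersive gives \<open>K w1 = det B w2\<close>, and by density this holds on \<open>U\<close>.
  Its right-hand side is nowhere zero, hence neither is \<open>K\<close>. Comparing cross products in this way
  spares the changes of basis between \<open>V\<close>, \<open>W1\<close> and \<open>W2\<close>.
\<close>

section \<open>Calculus of smooth maps\<close>

lemma Ck_on_cong:
  assumes "open S" "\<And>x. x \<in> S \<Longrightarrow> f x = g x"
  shows "Ck_on n S f \<longleftrightarrow> Ck_on n S g"
  using assms(2)
proof (induction n arbitrary: f g)
  case 0
  then show ?case by (simp cong: continuous_on_cong)
next
  case (Suc n)
  have D: "(f has_derivative D) (at x) \<longleftrightarrow> (g has_derivative D) (at x)" if "x \<in> S" for x D
    using has_derivative_transform_within_open[OF _ assms(1) that] Suc.prems by metis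
  then have fd: "frechet_derivative f (at x) = frechet_derivative g (at x)" if "x \<in> S" for x
    using that by (simp add: frechet_derivative_def)
  have "Ck_on n S (\<lambda>x. frechet_derivative f (at x) v) \<longleftrightarrow>
        Ck_on n S (\<lambda>x. frechet_derivative g (at x) v)" for v
    by (rule Suc.IH) (simp add: fd)
  then show ?case
    using D by (auto simp: differentiable_def)
qed

lemma Ck_on_Suc_derivative:
  assumes "Ck_on (Suc n) S f" "x \<in> S"
  shows "(f has_derivative frechet_derivative f (at x)) (at x)"
  using assms by (simp add: frechet_derivative_works[symmetric])

text \<open>
  The definition of \<open>Ck_on\<close> speaks of \<^const>\<open>frechet_derivative\<close>, a choice operator. This rule lets
  the inductions below work with any explicit formula for the derivative on \<open>S\<close>.
\<close>

lemma Ck_on_SucI: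
  assumes "open S" "\<And>x. x \<in> S \<Longrightarrow> (f has_derivative f' x) (at x)"
    and "\<And>v. Ck_on n S (\<lambda>x. f' x v)"
  shows "Ck_on (Suc n) S f"
proof -
  have "Ck_on n S (\<lambda>x. frechet_derivative f (at x) v)" for v
    using assms(3)[of v] Ck_on_cong[OF assms(1), of "\<lambda>x. frechet_derivative f (at x) v" "\<lambda>x. f' x v"]
    by (metis assms(2) frechet_derivative_at)
  then show ?thesis
    using assms(2) by (auto simp: differentiable_def)
qed

lemma Ck_on_SucD: "Ck_on (Suc n) S f \<Longrightarrow> Ck_on n S f"
proof (induction n arbitrary: f)
  case 0
  then show ?case
    by (auto simp: continuous_on_eq_continuous_at intro!: continuous_at_imp_continuous_on
        differentiable_imp_continuous_within)
next
  case (Suc n)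
  then show ?case by (metis Ck_on.simps(2))
qed

lemma Ck_on_const: "Ck_on n S (\<lambda>x. c)"
  by (induction n arbitrary: c) auto

lemma Ck_on_add:
  assumes "open S" "Ck_on n S f" "Ck_on n S g"
  shows "Ck_on n S (\<lambda>x. f x + g x)"
  using assms(2,3)
proof (induction n arbitrary: f g)
  case 0
  then show ?case by (auto intro: continuous_intros)
next
  case (Suc n)
  show ?case
  proof (rule Ck_on_SucI[OF assms(1)])
    show "((\<lambda>x. f x + g x) has_derivative
        (\<lambda>v. frechet_derivative f (at x) v + frechet_derivative g (at x) v)) (at x)"
      if "x \<in> S" for x
      using Suc.prems that by (intro has_derivative_add Ck_on_Suc_derivative)
  qed (use Suc in auto)
qed

text \<open>
  By the product rule the derivative is a sum of two terms of the same bilinear shape, so the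
  induction hypothesis applies to it. Products, scalar multiples, inner products and cross products
  are all instances.
\<close>

lemma Ck_on_bounded_bilinear:
  assumes B: "bounded_bilinear B" and "open S" "Ck_on n S f" "Ck_on n S g"
  shows "Ck_on n S (\<lambda>x. B (f x) (g x))"
  using assms(3,4)
proof (induction n arbitrary: f g)
  case 0
  then show ?case by (auto intro: bounded_bilinear.continuous_on[OF B])
next
  case (Suc n)
  show ?case
  proof (rule Ck_on_SucI[OF \<open>open S\<close>])
    show "((\<lambda>x. B (f x) (g x)) has_derivative
        (\<lambda>v. B (f x) (frechet_derivative g (at x) v) + B (frechet_derivative f (at x) v) (g x))) (at x)"
      if "x \<in> S" for x
      using Suc.prems that
      by (intro bounded_bilinear.FDERIV[OF B] Ck_on_Suc_derivative)
    show "Ck_on n S (\<lambda>x. B (f x) (frechet_derivative g (at x) v)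
                        + B (frechet_derivative f (at x) v) (g x))" for v
      using Suc.prems by (intro Ck_on_add \<open>open S\<close> Suc.IH) (auto intro: Ck_on_SucD simp del: Ck_on.simps, auto)
  qed
qed

text \<open>
  The derivative of \<open>1 / f\<close> is a product of the derivative of \<open>f\<close> and two copies of \<open>1 / f\<close>, all of
  which are of class \<open>C\<^sup>n\<close> by the induction hypothesis; the same bootstrap works for square roots.
\<close>

lemma Ck_on_inverse:
  fixes f :: "'a::euclidean_space \<Rightarrow> real"
  assumes "open S" "Ck_on n S f" and nz: "\<And>x. x \<in> S \<Longrightarrow> f x \<noteq> 0"
  shows "Ck_on n S (\<lambda>x. inverse (f x))"
  using assms(2)
proof (induction n)
  case 0
  then show ?case using nz by (auto intro: continuous_intros)
next
  case (Suc n)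
  then have I: "Ck_on n S (\<lambda>x. inverse (f x))" by (blast intro: Ck_on_SucD)
  show ?case
  proof (rule Ck_on_SucI[OF \<open>open S\<close>])
    show "((\<lambda>x. inverse (f x)) has_derivative
        (\<lambda>v. (- 1) * (inverse (f x) * frechet_derivative f (at x) v * inverse (f x)))) (at x)"
      if "x \<in> S" for x
      using Deriv.has_derivative_inverse[OF nz[OF that] Ck_on_Suc_derivative[OF Suc.prems that]]
      by simp
    show "Ck_on n S (\<lambda>x. (- 1) * (inverse (f x) * frechet_derivative f (at x) v * inverse (f x)))" for v
      using Suc.prems
      by (intro Ck_on_bounded_bilinear[OF bounded_bilinear_mult] I Ck_on_const \<open>open S\<close>) auto
  qed
qed

lemma Ck_on_sqrt:
  fixes f :: "'a::euclidean_space \<Rightarrow> real"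
  assumes "open S" "Ck_on n S f" and pos: "\<And>x. x \<in> S \<Longrightarrow> 0 < f x"
  shows "Ck_on n S (\<lambda>x. sqrt (f x))"
  using assms(2)
proof (induction n)
  case 0
  then show ?case by (auto intro: continuous_intros)
next
  case (Suc n)
  then have I: "Ck_on n S (\<lambda>x. inverse (sqrt (f x)))"
    using pos by (intro Ck_on_inverse \<open>open S\<close>) (auto dest: Ck_on_SucD simp del: Ck_on.simps, force)
  show ?case
  proof (rule Ck_on_SucI[OF \<open>open S\<close>])
    show "((\<lambda>x. sqrt (f x)) has_derivative
        (\<lambda>v. (1 / 2) * (frechet_derivative f (at x) v * inverse (sqrt (f x))))) (at x)"
      if "x \<in> S" for x
      using has_derivative_real_sqrt[OF pos[OF that] Ck_on_Suc_derivative[OF Suc.prems that]]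
      by (simp add: field_simps)
    show "Ck_on n S (\<lambda>x. (1 / 2) * (frechet_derivative f (at x) v * inverse (sqrt (f x))))" for v
      using Suc.prems
      by (intro Ck_on_bounded_bilinear[OF bounded_bilinear_mult] I Ck_on_const \<open>open S\<close>) auto
  qed
qed

text \<open>
  The normal curvature is given as a function of a point and a direction; it is used only along
  finitely many fixed directions.
\<close>

lemma Ck_on_slice:
  fixes F :: "'a::euclidean_space \<times> 'b::euclidean_space \<Rightarrow> 'c::real_normed_vector"
  assumes "open S" "Ck_on n (S \<times> T) F" "w \<in> T"
  shows "Ck_on n S (\<lambda>p. F (p, w))"
  using assms(2)
proof (induction n arbitrary: F)
  case 0
  then have "continuous_on (S \<times> T) F" by simp
  then have "continuous_on S (F \<circ> (\<lambda>p. (p, w)))"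
    using \<open>w \<in> T\<close> by (intro continuous_on_compose continuous_intros) (auto elim: continuous_on_subset)
  then show ?case by (simp add: o_def)
next
  case (Suc n)
  show ?case
  proof (rule Ck_on_SucI[OF \<open>open S\<close>])
    show "((\<lambda>p. F (p, w)) has_derivative (\<lambda>v. frechet_derivative F (at (p, w)) (v, 0))) (at p)"
      if "p \<in> S" for p
    proof -
      have "(F has_derivative frechet_derivative F (at (p, w))) (at (p, w))"
        using that \<open>w \<in> T\<close> by (intro Ck_on_Suc_derivative[OF Suc.prems]) simp
      moreover have "((\<lambda>p. (p, w)) has_derivative (\<lambda>v. (v, 0))) (at p)"
        by (auto intro!: derivative_eq_intros)
      ultimately show ?thesis
        using has_derivative_compose by blast
    qed
    show "Ck_on n S (\<lambda>p. frechet_derivative F (at (p, w)) (v, 0))" for v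
      by (rule Suc.IH) (use Suc.prems in \<open>simp only: Ck_on.simps\<close>)
  qed
qed

lemma smooth_on_continuous: "smooth_on S f \<Longrightarrow> continuous_on S f"
  unfolding smooth_on_def using Ck_on.simps(1) by blast

lemma smooth_on_derivative:
  assumes "smooth_on S f"
  shows "x \<in> S \<Longrightarrow> (f has_derivative frechet_derivative f (at x)) (at x)"
    and "smooth_on S (\<lambda>x. frechet_derivative f (at x) v)"
proof -
  have C: "Ck_on (Suc n) S f" for n
    using assms by (simp add: smooth_on_def del: Ck_on.simps)
  show "x \<in> S \<Longrightarrow> (f has_derivative frechet_derivative f (at x)) (at x)"
    by (rule Ck_on_Suc_derivative[OF C])
  show "smooth_on S (\<lambda>x. frechet_derivative f (at x) v)"
    unfolding smooth_on_def using C by simp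
qed

lemma smooth_on_const: "smooth_on S (\<lambda>x. c)"
  by (simp add: smooth_on_def Ck_on_const)

lemma smooth_on_cong: "open S \<Longrightarrow> (\<And>x. x \<in> S \<Longrightarrow> f x = g x) \<Longrightarrow> smooth_on S f \<longleftrightarrow> smooth_on S g"
  by (simp add: smooth_on_def Ck_on_cong[of S f g])

lemma smooth_on_add: "open S \<Longrightarrow> smooth_on S f \<Longrightarrow> smooth_on S g \<Longrightarrow> smooth_on S (\<lambda>x. f x + g x)"
  by (simp add: smooth_on_def Ck_on_add)

lemma smooth_on_bounded_bilinear:
  "bounded_bilinear B \<Longrightarrow> open S \<Longrightarrow> smooth_on S f \<Longrightarrow> smooth_on S g \<Longrightarrow> smooth_on S (\<lambda>x. B (f x) (g x))"
  by (simp add: smooth_on_def Ck_on_bounded_bilinear)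

lemmas smooth_on_mult = smooth_on_bounded_bilinear[OF bounded_bilinear_mult]
lemmas smooth_on_scaleR = smooth_on_bounded_bilinear[OF bounded_bilinear_scaleR]
lemmas smooth_on_inner = smooth_on_bounded_bilinear[OF bounded_bilinear_inner]

lemma smooth_on_bounded_linear:
  assumes "bounded_linear h" "open S" "smooth_on S f"
  shows "smooth_on S (\<lambda>x. h (f x))"
proof -
  have "bounded_bilinear (\<lambda>(r::real) y. r *\<^sub>R h y)"
    using bounded_bilinear.comp[OF bounded_bilinear_scaleR bounded_linear_ident assms(1)] by simp
  from smooth_on_bounded_bilinear[OF this assms(2) smooth_on_const[of _ 1] assms(3)]
  show ?thesis by simp
qed

lemma smooth_on_minus: "open S \<Longrightarrow> smooth_on S f \<Longrightarrow> smooth_on S (\<lambda>x. - f x)"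
  by (rule smooth_on_bounded_linear[OF bounded_linear_minus[OF bounded_linear_ident]])

lemma smooth_on_diff: "open S \<Longrightarrow> smooth_on S f \<Longrightarrow> smooth_on S g \<Longrightarrow> smooth_on S (\<lambda>x. f x - g x)"
  using smooth_on_add[OF _ _ smooth_on_minus, of S f g] by simp

lemma smooth_on_inverse:
  fixes f :: "'a::euclidean_space \<Rightarrow> real"
  shows "open S \<Longrightarrow> smooth_on S f \<Longrightarrow> (\<And>x. x \<in> S \<Longrightarrow> f x \<noteq> 0) \<Longrightarrow> smooth_on S (\<lambda>x. inverse (f x))"
  by (simp add: smooth_on_def Ck_on_inverse)

lemma smooth_on_norm:
  fixes f :: "'a::euclidean_space \<Rightarrow> 'b::real_inner"
  assumes "open S" "smooth_on S f" "\<And>x. x \<in> S \<Longrightarrow> f x \<noteq> 0"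
  shows "smooth_on S (\<lambda>x. norm (f x))"
  using smooth_on_inner[OF assms(1,2,2)] assms(1,3)
  unfolding smooth_on_def norm_eq_sqrt_inner by (simp add: Ck_on_sqrt)

lemma smooth_on_slice:
  "open S \<Longrightarrow> smooth_on (S \<times> T) F \<Longrightarrow> w \<in> T \<Longrightarrow> smooth_on S (\<lambda>p. F (p, w))"
  unfolding smooth_on_def by (blast intro: Ck_on_slice)

lemma smooth_on_nth: "open S \<Longrightarrow> smooth_on S f \<Longrightarrow> smooth_on S (\<lambda>x. f x $ i)"
  by (rule smooth_on_bounded_linear[OF bounded_linear_vec_nth])

lemma smooth_on_sum:
  "finite I \<Longrightarrow> open S \<Longrightarrow> (\<And>i. i \<in> I \<Longrightarrow> smooth_on S (f i)) \<Longrightarrow> smooth_on S (\<lambda>x. \<Sum>i\<in>I. f i x)"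
  by (induction rule: finite_induct) (auto intro: smooth_on_add smooth_on_const)

lemma smooth_on_vec:
  fixes f :: "'a::euclidean_space \<Rightarrow> ('b::euclidean_space)^'n"
  assumes "open S" "\<And>i. smooth_on S (\<lambda>x. f x $ i)"
  shows "smooth_on S f"
proof -
  have "linear (axis i :: 'b \<Rightarrow> 'b^'n)" for i
    by (rule linearI) (auto simp: axis_def vec_eq_iff)
  then have "smooth_on S (\<lambda>x. axis i (f x $ i) :: 'b^'n)" for i
    by (intro smooth_on_bounded_linear[of "axis i"] assms) (simp add: linear_conv_bounded_linear)
  then have "smooth_on S (\<lambda>x. \<Sum>i\<in>UNIV. axis i (f x $ i) :: 'b^'n)"
    using assms(1) by (intro smooth_on_sum) auto
  moreover have "f x = (\<Sum>i\<in>UNIV. axis i (f x $ i))" for x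
    by (simp add: vec_eq_iff axis_def)
  ultimately show ?thesis by simp
qed

lemma smooth_on_matrix:
  fixes f :: "'a::euclidean_space \<Rightarrow> real^'n^'m"
  assumes "open S" "\<And>i j. smooth_on S (\<lambda>x. f x $ i $ j)"
  shows "smooth_on S f"
  by (rule smooth_on_vec[OF assms(1)], rule smooth_on_vec[OF assms(1)], rule assms(2))

lemma smooth_on_matrix_mult:
  fixes f :: "'a::euclidean_space \<Rightarrow> real^'n^'m" and g :: "'a \<Rightarrow> real^'k^'n"
  assumes "open S" "smooth_on S f" "smooth_on S g"
  shows "smooth_on S (\<lambda>x. f x ** g x)"
  by (rule smooth_on_matrix[OF assms(1)])
     (simp add: matrix_matrix_mult_def assms smooth_on_sum smooth_on_mult smooth_on_nth)

lemma smooth_on_transpose: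
  fixes f :: "'a::euclidean_space \<Rightarrow> real^'n^'m"
  shows "open S \<Longrightarrow> smooth_on S f \<Longrightarrow> smooth_on S (\<lambda>x. transpose (f x))"
  by (rule smooth_on_matrix) (simp_all add: transpose_def smooth_on_nth)

lemma smooth_on_column:
  fixes f :: "'a::euclidean_space \<Rightarrow> real^'n^'m"
  shows "open S \<Longrightarrow> smooth_on S f \<Longrightarrow> smooth_on S (\<lambda>x. column i (f x))"
  by (rule smooth_on_vec) (simp_all add: column_def smooth_on_nth)

lemma smooth_on_cross:
  "open S \<Longrightarrow> smooth_on S f \<Longrightarrow> smooth_on S g \<Longrightarrow> smooth_on S (\<lambda>x. cross3 (f x) (g x))"
  by (rule smooth_on_bounded_bilinear[OF bilinear_cross[unfolded bilinear_conv_bounded_bilinear]])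

section \<open>Symmetry of second derivatives\<close>

text \<open>
  The mean value theorem, applied once along \<open>u\<close> and once along \<open>v\<close>, turns the second difference
  over a parallelogram into a mixed derivative at an interior point. The left-hand side
  is symmetric in \<open>u\<close> and \<open>v\<close>, which is what makes mixed derivatives commute.
\<close>

lemma second_difference_mean_value:
  fixes f :: "'a::euclidean_space \<Rightarrow> real"
  assumes "Ck_on 2 S f" "0 < t" and S: "\<And>a b. 0 \<le> a \<Longrightarrow> a \<le> t \<Longrightarrow> 0 \<le> b \<Longrightarrow> b \<le> t \<Longrightarrow> p + a *\<^sub>R u + b *\<^sub>R v \<in> S"
  obtains a b where "0 < a" "a < t" "0 < b" "b < t"
    "f (p + t *\<^sub>R u + t *\<^sub>R v) - f (p + t *\<^sub>R u) - f (p + t *\<^sub>R v) + f p =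
     t\<^sup>2 * frechet_derivative (\<lambda>q. frechet_derivative f (at q) u) (at (p + a *\<^sub>R u + b *\<^sub>R v)) v"
proof -
  let ?Df = "\<lambda>q. frechet_derivative f (at q)"
  let ?D2 = "\<lambda>q. frechet_derivative (\<lambda>q. ?Df q u) (at q)"
  have C2: "Ck_on (Suc (Suc 0)) S f" using assms(1) by (simp only: numeral_2_eq_2)
  then have D1: "(f has_derivative ?Df q) (at q)" if "q \<in> S" for q
    using that by (rule Ck_on_Suc_derivative)
  from C2 have "Ck_on (Suc 0) S (\<lambda>q. ?Df q u)" by (metis Ck_on.simps(2))
  then have D2: "((\<lambda>q. ?Df q u) has_derivative ?D2 q) (at q)" if "q \<in> S" for q
    using that by (rule Ck_on_Suc_derivative)
  have hu: "((\<lambda>s. f (p + s *\<^sub>R u + b *\<^sub>R v)) has_real_derivative ?Df (p + a *\<^sub>R u + b *\<^sub>R v) u) (at a)"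
    if "0 \<le> a" "a \<le> t" "0 \<le> b" "b \<le> t" for a b
  proof -
    have "((\<lambda>s. p + s *\<^sub>R u + b *\<^sub>R v) has_derivative (\<lambda>h. h *\<^sub>R u)) (at a)"
      by (auto intro!: derivative_eq_intros)
    from has_derivative_compose[OF this D1[OF S[OF that]]]
    show ?thesis
      using has_derivative_linear[OF D1[OF S[OF that]]]
      by (simp add: has_field_derivative_def linear_scale mult.commute[of _ "?Df _ u"] cong: if_cong)
  qed
  have hv: "((\<lambda>s. ?Df (p + a *\<^sub>R u + s *\<^sub>R v) u) has_real_derivative ?D2 (p + a *\<^sub>R u + b *\<^sub>R v) v) (at b)"
    if "0 \<le> a" "a \<le> t" "0 \<le> b" "b \<le> t" for a b
  proof -
    have "((\<lambda>s. p + a *\<^sub>R u + s *\<^sub>R v) has_derivative (\<lambda>h. h *\<^sub>R v)) (at b)"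
      by (auto intro!: derivative_eq_intros)
    from has_derivative_compose[OF this D2[OF S[OF that]]]
    show ?thesis
      using has_derivative_linear[OF D2[OF S[OF that]]]
      by (simp add: has_field_derivative_def linear_scale mult.commute[of _ "?D2 _ v"] cong: if_cong)
  qed
  have "\<exists>a. 0 < a \<and> a < t \<and> (f (p + t *\<^sub>R u + t *\<^sub>R v) - f (p + t *\<^sub>R u + 0 *\<^sub>R v)) -
      (f (p + 0 *\<^sub>R u + t *\<^sub>R v) - f (p + 0 *\<^sub>R u + 0 *\<^sub>R v)) =
      (t - 0) * (?Df (p + a *\<^sub>R u + t *\<^sub>R v) u - ?Df (p + a *\<^sub>R u + 0 *\<^sub>R v) u)"
    using \<open>0 < t\<close> by (intro MVT2[where f = "\<lambda>s. f (p + s *\<^sub>R u + t *\<^sub>R v) - f (p + s *\<^sub>R u + 0 *\<^sub>R v)"] DERIV_diff hu) auto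
  then obtain a where a: "0 < a" "a < t" and
    eq1: "f (p + t *\<^sub>R u + t *\<^sub>R v) - f (p + t *\<^sub>R u) - f (p + t *\<^sub>R v) + f p =
      t * (?Df (p + a *\<^sub>R u + t *\<^sub>R v) u - ?Df (p + a *\<^sub>R u + 0 *\<^sub>R v) u)"
    by (auto simp: algebra_simps)
  have "\<exists>b. 0 < b \<and> b < t \<and> ?Df (p + a *\<^sub>R u + t *\<^sub>R v) u - ?Df (p + a *\<^sub>R u + 0 *\<^sub>R v) u =
      (t - 0) * ?D2 (p + a *\<^sub>R u + b *\<^sub>R v) v"
    using \<open>0 < t\<close> a by (intro MVT2[where f = "\<lambda>s. ?Df (p + a *\<^sub>R u + s *\<^sub>R v) u"] hv) auto
  then show ?thesis
    using that a eq1 by (auto simp: power2_eq_square)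
qed

text \<open>
  Both mixed derivatives, evaluated at points of an arbitrarily small parallelogram at \<open>p\<close>, agree with
  the same second difference divided by \<open>t\<^sup>2\<close>; continuity brings both points back to \<open>p\<close>.
\<close>

lemma mixed_derivatives_commute_real:
  fixes f :: "'a::euclidean_space \<Rightarrow> real"
  assumes "open S" "Ck_on 2 S f" "p \<in> S"
  shows "frechet_derivative (\<lambda>q. frechet_derivative f (at q) u) (at p) v =
         frechet_derivative (\<lambda>q. frechet_derivative f (at q) v) (at p) u"
proof -
  define A where "A = (\<lambda>q. frechet_derivative (\<lambda>q. frechet_derivative f (at q) u) (at q) v)"
  define B where "B = (\<lambda>q. frechet_derivative (\<lambda>q. frechet_derivative f (at q) v) (at q) u)"
  have "continuous_on S A" "continuous_on S B"
    using assms(2) unfolding A_def B_def by (auto simp: numeral_2_eq_2)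
  have "\<bar>A p - B p\<bar> < e" if "e > 0" for e
  proof -
    have "\<forall>\<^sub>F q in nhds p. q \<in> S \<and> dist (A q) (A p) < e/2 \<and> dist (B q) (B p) < e/2"
    proof (intro eventually_conj)
      have "isCont A p" "isCont B p"
        using \<open>continuous_on S A\<close> \<open>continuous_on S B\<close> assms by (simp_all add: continuous_on_eq_continuous_at)
      then have "(A \<longlongrightarrow> A p) (nhds p)" "(B \<longlongrightarrow> B p) (nhds p)"
        by (simp_all add: isCont_def tendsto_nhds_iff)
      then show "\<forall>\<^sub>F q in nhds p. dist (A q) (A p) < e/2" "\<forall>\<^sub>F q in nhds p. dist (B q) (B p) < e/2"
        using tendstoD[OF _ half_gt_zero[OF \<open>e > 0\<close>]] by blast+
      show "\<forall>\<^sub>F q in nhds p. q \<in> S" using assms(1,3) by (rule eventually_nhds_in_open)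
    qed
    then obtain d where "d > 0" and d: "\<And>q. dist q p < d \<Longrightarrow> q \<in> S \<and> dist (A q) (A p) < e/2 \<and> dist (B q) (B p) < e/2"
      unfolding eventually_nhds_metric by blast
    \<comment> \<open>so small that the parallelogram with sides \<open>t u\<close> and \<open>t v\<close> stays within \<open>d\<close> of \<open>p\<close>; the summand 1 covers \<open>u = v = 0\<close>\<close>
    define t where "t = d / (2 * (norm u + norm v + 1))"
    have "0 < norm u + norm v + 1" by (simp add: add_nonneg_pos)
    then have "t > 0" using \<open>d > 0\<close> by (simp add: t_def)
    have near: "dist (p + a *\<^sub>R u + b *\<^sub>R v) p < d" if "0 \<le> a" "a \<le> t" "0 \<le> b" "b \<le> t" for a b
    proof -
      have "dist (p + a *\<^sub>R u + b *\<^sub>R v) p \<le> a * norm u + b * norm v"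
        using norm_triangle_ineq[of "a *\<^sub>R u" "b *\<^sub>R v"] that by (simp add: dist_norm)
      also have "\<dots> \<le> t * (norm u + norm v + 1)"
        using that \<open>t > 0\<close> mult_right_mono[of a t "norm u"] mult_right_mono[of b t "norm v"]
        by (simp add: distrib_left)
      also have "\<dots> = d / 2" using \<open>0 < norm u + norm v + 1\<close> by (simp add: t_def field_simps)
      finally show ?thesis using \<open>d > 0\<close> by simp
    qed
    obtain a b where ab: "0 < a" "a < t" "0 < b" "b < t"
      "f (p + t *\<^sub>R u + t *\<^sub>R v) - f (p + t *\<^sub>R u) - f (p + t *\<^sub>R v) + f p = t\<^sup>2 * A (p + a *\<^sub>R u + b *\<^sub>R v)"
      unfolding A_def
      by (rule second_difference_mean_value[OF assms(2) \<open>t > 0\<close>, of p u v]) (use near d in auto)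
    have "p + b *\<^sub>R v + a *\<^sub>R u \<in> S" if "0 \<le> b" "b \<le> t" "0 \<le> a" "a \<le> t" for a b
      using near[of a b] d that by (simp add: ac_simps)
    note swapped = this
    obtain b' a' where ab': "0 < b'" "b' < t" "0 < a'" "a' < t"
      "f (p + t *\<^sub>R v + t *\<^sub>R u) - f (p + t *\<^sub>R v) - f (p + t *\<^sub>R u) + f p = t\<^sup>2 * B (p + b' *\<^sub>R v + a' *\<^sub>R u)"
      unfolding B_def
      by (rule second_difference_mean_value[OF assms(2) \<open>t > 0\<close>, of p v u]) (use swapped in auto)
    have "p + t *\<^sub>R v + t *\<^sub>R u = p + t *\<^sub>R u + t *\<^sub>R v"
      "p + b' *\<^sub>R v + a' *\<^sub>R u = p + a' *\<^sub>R u + b' *\<^sub>R v"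
      by (simp_all add: ac_simps)
    note swap = this
    have "t\<^sup>2 * A (p + a *\<^sub>R u + b *\<^sub>R v) = t\<^sup>2 * B (p + a' *\<^sub>R u + b' *\<^sub>R v)"
      using ab(5) ab'(5) unfolding swap by linarith
    then have "A (p + a *\<^sub>R u + b *\<^sub>R v) = B (p + a' *\<^sub>R u + b' *\<^sub>R v)" using \<open>t > 0\<close> by simp
    moreover have "dist (A (p + a *\<^sub>R u + b *\<^sub>R v)) (A p) < e/2" "dist (B (p + a' *\<^sub>R u + b' *\<^sub>R v)) (B p) < e/2"
      using d near ab ab' by (auto simp: less_imp_le)
    ultimately show ?thesis unfolding dist_real_def by linarith
  qed
  then have "\<bar>A p - B p\<bar> \<le> 0"
    by (metis dense_ge less_imp_le)
  then have "A p = B p" by simp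
  then show ?thesis by (simp add: A_def B_def)
qed

text \<open>
  Testing against every vector \<open>c\<close> reduces the claim to the real function \<open>f \<bullet> c\<close>.
\<close>

lemma mixed_derivatives_commute:
  fixes f :: "'a::euclidean_space \<Rightarrow> 'b::real_inner"
  assumes "open S" "smooth_on S f" "p \<in> S"
  shows "frechet_derivative (\<lambda>q. frechet_derivative f (at q) u) (at p) v =
         frechet_derivative (\<lambda>q. frechet_derivative f (at q) v) (at p) u"
proof -
  have "frechet_derivative (\<lambda>q. frechet_derivative f (at q) u) (at p) v \<bullet> c =
        frechet_derivative (\<lambda>q. frechet_derivative f (at q) v) (at p) u \<bullet> c" for c
  proof -
    have inner_c: "frechet_derivative (\<lambda>q. g q \<bullet> c) (at q) w = frechet_derivative g (at q) w \<bullet> c"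
      if "smooth_on S g" "q \<in> S" for g :: "'a \<Rightarrow> 'b" and q w
      using has_derivative_inner_left[OF smooth_on_derivative(1)[OF that]]
      by (rule frechet_derivative_at[symmetric, THEN fun_cong])
    have second: "frechet_derivative (\<lambda>q. frechet_derivative (\<lambda>q. f q \<bullet> c) (at q) w) (at p) z =
        frechet_derivative (\<lambda>q. frechet_derivative f (at q) w) (at p) z \<bullet> c" for w z
    proof -
      have "frechet_derivative (\<lambda>q. frechet_derivative (\<lambda>q. f q \<bullet> c) (at q) w) (at p) =
            frechet_derivative (\<lambda>q. frechet_derivative f (at q) w \<bullet> c) (at p)"
      proof (rule frechet_derivative_transform_within_open[OF _ \<open>open S\<close> \<open>p \<in> S\<close>])
        have "smooth_on S (\<lambda>q. frechet_derivative (\<lambda>q. f q \<bullet> c) (at q) w)"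
          by (intro smooth_on_derivative(2) smooth_on_inner smooth_on_const assms)
        then show "(\<lambda>q. frechet_derivative (\<lambda>q. f q \<bullet> c) (at q) w) differentiable at p"
          using smooth_on_derivative(1)[OF _ \<open>p \<in> S\<close>] unfolding differentiable_def by blast
      qed (simp add: inner_c assms)
      then show ?thesis
        by (simp add: inner_c smooth_on_derivative(2) assms)
    qed
    have "smooth_on S (\<lambda>q. f q \<bullet> c)" by (intro smooth_on_inner smooth_on_const assms)
    then have "Ck_on 2 S (\<lambda>q. f q \<bullet> c)" unfolding smooth_on_def by blast
    from mixed_derivatives_commute_real[OF \<open>open S\<close> this \<open>p \<in> S\<close>, of u v]
    show ?thesis by (simp add: second)
  qed
  then show ?thesis by (metis vector_eq_rdot)
qed

section \<open>Matrices with two columns\<close>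

lemma matrix_inv_eqI:
  fixes A :: "real^'n^'n"
  assumes "A ** B = mat 1"
  shows "matrix_inv A = B"
proof -
  have BA: "B ** A = mat 1" using assms by (simp add: matrix_left_right_inverse)
  then have "\<exists>C. A ** C = mat 1 \<and> C ** A = mat 1" using assms by blast
  then have "A ** matrix_inv A = mat 1"
    unfolding matrix_inv_def by (rule someI2_ex) simp
  then have "B ** (A ** matrix_inv A) = B" by simp
  then show ?thesis by (simp add: matrix_mul_assoc BA)
qed

lemma matrix_inv_cancel:
  fixes A :: "real^'n^'n"
  assumes "det A \<noteq> 0"
  shows "A ** matrix_inv A = mat 1" "matrix_inv A ** A = mat 1"
proof -
  obtain B where "A ** B = mat 1"
    using assms by (auto simp: invertible_det_nz[symmetric] invertible_def)
  then show "A ** matrix_inv A = mat 1" by (simp add: matrix_inv_eqI)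
  then show "matrix_inv A ** A = mat 1" by (simp add: matrix_left_right_inverse)
qed

text \<open>
  The adjugate formula displays the entries of the inverse as smooth functions of the entries of \<open>A\<close>.
\<close>

lemma matrix_inv_2:
  fixes A :: "real^2^2"
  assumes "det A \<noteq> 0"
  shows "matrix_inv A = vector [vector [A$2$2, - A$1$2], vector [- A$2$1, A$1$1]] /\<^sub>R det A"
    (is "_ = ?B")
proof -
  have "A ** vector [vector [A$2$2, - A$1$2], vector [- A$2$1, A$1$1]] = mat (det A)"
    by (simp add: matrix_matrix_mult_def mat_def vec_eq_iff forall_2 sum_2 det_2)
  then have "A ** ?B = mat 1"
    using assms by (simp add: matrix_scalar_ac scalar_matrix_assoc[symmetric])
      (simp add: mat_def vec_eq_iff)
  then show ?thesis by (rule matrix_inv_eqI)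
qed

lemma smooth_on_det_2:
  fixes f :: "'a::euclidean_space \<Rightarrow> real^2^2"
  assumes "open S" "smooth_on S f"
  shows "smooth_on S (\<lambda>x. det (f x))"
  using assms by (simp add: det_2 smooth_on_diff smooth_on_mult smooth_on_nth)

lemma smooth_on_matrix_inv_2:
  fixes f :: "'a::euclidean_space \<Rightarrow> real^2^2"
  assumes S: "open S" and f: "smooth_on S f" and "\<And>x. x \<in> S \<Longrightarrow> det (f x) \<noteq> 0"
  shows "smooth_on S (\<lambda>x. matrix_inv (f x))"
proof -
  have "smooth_on S (\<lambda>x. inverse (det (f x)) *\<^sub>R
      (vector [vector [f x$2$2, - f x$1$2], vector [- f x$2$1, f x$1$1]] :: real^2^2))"
  proof (rule smooth_on_scaleR[OF S smooth_on_inverse[OF S smooth_on_det_2[OF S f]] smooth_on_matrix[OF S]])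
    show "smooth_on S (\<lambda>x. (vector [vector [f x$2$2, - f x$1$2], vector [- f x$2$1, f x$1$1]]
        :: real^2^2) $ i $ j)" for i j
      using exhaust_2[of i] exhaust_2[of j] S f
      by (elim disjE; simp add: smooth_on_minus smooth_on_nth)
  qed (use assms in auto)
  then show ?thesis
    by (rule smooth_on_cong[OF S, THEN iffD1, rotated]) (simp add: matrix_inv_2 assms)
qed

lemma matrix_mult_minus_left: "(- A) ** B = - (A ** (B :: real^'k^'n))"
  by (simp add: matrix_matrix_mult_def vec_eq_iff sum_negf)

lemma inner_transpose_mult: "v \<bullet> (transpose A *v w) = (A *v v) \<bullet> (w :: real^'m)"
  by (metis dot_lmul_matrix inner_commute transpose_matrix_vector)

text \<open>
  The formula is uniform in \<open>i\<close> and \<open>j\<close>: for \<open>i = j\<close> it reads \<open>(4 q - q - q) / 2\<close>. Moreover it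
  evaluates \<open>q\<close> only at nonzero vectors, where the normal curvature is defined.
\<close>

lemma symmetric_matrix_polarization:
  fixes N :: "real^'n^'n"
  assumes "transpose N = N"
  defines "q \<equiv> \<lambda>\<omega>. \<omega> \<bullet> (N *v \<omega>)"
  shows "N $ i $ j = (q (axis i 1 + axis j 1) - q (axis i 1) - q (axis j 1)) / 2"
proof -
  have e: "axis i 1 \<bullet> (N *v axis j 1) = N $ i $ j" for i j
    by (simp add: inner_axis_axis inner_axis' matrix_vector_mul_component inner_axis)
  have "N $ j $ i = N $ i $ j" using assms(1) by (metis transpose_def vec_lambda_beta)
  then show ?thesis
    by (simp add: q_def e matrix_vector_right_distrib inner_add_left inner_add_right)
qed

text \<open>
  For a matrix with two columns this vector replaces the determinant: it is nonzero exactly when the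
  columns are independent, and multiplication on the right by \<open>M\<close> scales it by \<open>det M\<close>.
\<close>

definition cross_cols :: "real^2^3 \<Rightarrow> real^3" where
  "cross_cols A = cross3 (column 1 A) (column 2 A)"

lemma cross_cols_mult: "cross_cols (A ** M) = det M *\<^sub>R cross_cols A"
  by (simp add: cross_cols_def vec_eq_iff forall_3 cross_components column_def
      matrix_matrix_mult_def sum_2 det_2 algebra_simps)

text \<open>
  The Cauchy-Binet formula for two columns.
\<close>

lemma det_transpose_mult: "det (transpose A ** B) = cross_cols A \<bullet> cross_cols B"
  by (simp add: cross_cols_def inner_vec_def sum_3 cross_components column_def transpose_def
      matrix_matrix_mult_def det_2 algebra_simps)

lemma det_gram_pos: "cross_cols A \<noteq> 0 \<Longrightarrow> 0 < det (transpose A ** A)"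
  by (simp add: det_transpose_mult)

lemma gram_form_pos:
  assumes "cross_cols W \<noteq> 0" "\<omega> \<noteq> 0"
  shows "0 < \<omega> \<bullet> ((transpose W ** W) *v \<omega>)"
proof -
  have "\<omega> \<bullet> ((transpose W ** W) *v \<omega>) = (W *v \<omega>) \<bullet> (W *v \<omega>)"
    by (simp only: matrix_vector_mul_assoc[symmetric] inner_transpose_mult)
  moreover have "W *v \<omega> \<noteq> 0"
  proof
    assume "W *v \<omega> = 0"
    then have "(transpose W ** W) *v \<omega> = 0" by (simp add: matrix_vector_mul_assoc[symmetric] del: vector_transpose_matrix)
    then have "matrix_inv (transpose W ** W) *v ((transpose W ** W) *v \<omega>) = 0" by simp
    then show False
      using det_gram_pos[OF assms(1)] assms(2)
      by (simp add: matrix_vector_mul_assoc matrix_inv_cancel)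
  qed
  ultimately show ?thesis by simp
qed

lemma matrix_vector_mult_columns:
  "(A :: real^2^3) *v c = c $ 1 *\<^sub>R column 1 A + c $ 2 *\<^sub>R column 2 A"
  by (simp add: vec_eq_iff matrix_vector_mult_def sum_2 column_def algebra_simps)

lemma span_columns_factor:
  fixes A B :: "real^2^3"
  assumes "\<And>j. column j B \<in> span {column 1 A, column 2 A}"
  obtains C where "B = A ** C"
proof -
  have "\<exists>c. column j B = A *v c" for j
  proof -
    obtain a b where "column j B - a *\<^sub>R column 1 A = b *\<^sub>R column 2 A"
      using assms[of j] by (auto simp: span_breakdown_eq)
    then have "column j B = A *v vector [a, b]"
      by (simp add: matrix_vector_mult_columns algebra_simps)
    then show ?thesis ..
  qed
  then obtain c where c: "\<And>j. column j B = A *v c j" by metis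
  have "B = A ** (\<chi> i j. c j $ i)"
    using c by (simp add: vec_eq_iff column_def matrix_matrix_mult_def matrix_vector_mult_def)
  then show ?thesis by (rule that)
qed

lemma cross_nonzero_if_independent:
  fixes a b :: "real^3"
  assumes "independent {a, b}" "a \<noteq> b"
  shows "cross3 a b \<noteq> 0"
proof
  assume "cross3 a b = 0"
  then have "a = 0 \<or> b = 0 \<or> (\<exists>c. b = c *\<^sub>R a)"
    by (simp add: cross_eq_0 collinear_lemma)
  moreover have "a \<noteq> 0" "b \<noteq> 0" using assms dependent_zero by auto
  moreover have "b \<notin> span {a}" using assms
    by (metis Diff_insert_absorb dependent_def insert_commute insert_iff singletonD)
  ultimately show False using span_mul span_base by blast
qed

text \<open>
  Expanding \<open>N \<times> (v \<times> N)\<close> for \<open>N = a \<times> b\<close> in two ways gives \<open>\<parallel>N\<parallel>\<^sup>2 v\<close> on one side and a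
  combination of \<open>a\<close> and \<open>b\<close> on the other.
\<close>

lemma orthogonal_cross_in_span:
  fixes a b v :: "real^3"
  assumes N: "cross3 a b \<noteq> 0" and "v \<bullet> cross3 a b = 0"
  shows "v \<in> span {a, b}"
proof -
  let ?N = "cross3 a b"
  have "(?N \<bullet> ?N) *\<^sub>R v = cross3 ?N (cross3 v ?N)"
    using assms by (simp add: Lagrange[of ?N v ?N] inner_commute)
  also have "\<dots> = cross3 ?N ((v \<bullet> b) *\<^sub>R a - (v \<bullet> a) *\<^sub>R b)"
    by (simp only: Lagrange[of v a b])
  also have "\<dots> = (v \<bullet> a) *\<^sub>R cross3 b ?N - (v \<bullet> b) *\<^sub>R cross3 a ?N"
    by (simp add: Cross3.right_diff_distrib cross_mult_right cross_skew[of ?N])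
  also have "\<dots> \<in> span {a, b}"
    unfolding Lagrange by (intro span_diff span_mul span_base) auto
  finally have "inverse (?N \<bullet> ?N) *\<^sub>R ((?N \<bullet> ?N) *\<^sub>R v) \<in> span {a, b}" by (rule span_mul)
  then show ?thesis using N by simp
qed

lemma cross_parallel_unit_normal:
  fixes a b \<nu> :: "real^3"
  assumes "norm \<nu> = 1" "\<nu> \<bullet> a = 0" "\<nu> \<bullet> b = 0"
  shows "cross3 a b = (\<nu> \<bullet> cross3 a b) *\<^sub>R \<nu>"
proof -
  have "cross3 \<nu> (cross3 a b) = 0" using assms by (simp add: Lagrange)
  then have "cross3 \<nu> (cross3 \<nu> (cross3 a b)) = 0" by simp
  then show ?thesis using assms by (simp add: Lagrange[of \<nu> \<nu>] norm_eq_1)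
qed

section \<open>Tangent moving bases and unit normals\<close>

text \<open>
  This is how identities pass from the immersive points of a proper frontal to its singular points.
\<close>

lemma eq_on_if_eq_off_empty_interior:
  fixes f g :: "'a::topological_space \<Rightarrow> 'b::t2_space"
  assumes "open U" "interior N = {}" "continuous_on U f" "continuous_on U g"
    and eq: "\<And>p. p \<in> U - N \<Longrightarrow> f p = g p" and "p \<in> U"
  shows "f p = g p"
proof (rule ccontr)
  assume "f p \<noteq> g p"
  obtain V W where VW: "open V" "open W" "f p \<in> V" "g p \<in> W" "V \<inter> W = {}"
    using hausdorff[OF \<open>f p \<noteq> g p\<close>] by metis
  have "open ((U \<inter> f -` V) \<inter> (U \<inter> g -` W))"
    by (rule open_Int[OF continuous_open_preimage[OF assms(3,1) VW(1)]
          continuous_open_preimage[OF assms(4,1) VW(2)]])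
  moreover have "(U \<inter> f -` V) \<inter> (U \<inter> g -` W) \<subseteq> N"
    using VW eq by auto
  ultimately have "(U \<inter> f -` V) \<inter> (U \<inter> g -` W) \<subseteq> interior N"
    by (rule interior_maximal[rotated])
  then show False using VW \<open>p \<in> U\<close> \<open>interior N = {}\<close> by auto
qed

lemma column_Jac: "column j (Jac f p) = frechet_derivative f (at p) (axis j 1)"
  by (simp add: jacobian_def matrix_def column_def vec_eq_iff)

lemma tmb_cross_nonzero: "tmb U f W \<Longrightarrow> p \<in> U \<Longrightarrow> cross_cols (W p) \<noteq> 0"
  unfolding tmb_def cross_cols_def Let_def by (simp add: cross_nonzero_if_independent)

text \<open>
  The columns of \<open>Jac f p\<close> lie in the span of those of \<open>W p\<close>, so \<open>Jac f p = W p ** C\<close> for some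
  \<open>C\<close>; the Gram matrix in the definition of \<open>Lam\<close> recovers \<open>C\<close>.
\<close>

lemma tmb_Jac:
  assumes "tmb U f W" "p \<in> U"
  shows "Jac f p = W p ** transpose (Lam f W p)"
proof -
  have "column j (Jac f p) \<in> span {column 1 (W p), column 2 (W p)}" for j
    using assms exhaust_2[of j] by (auto simp: column_Jac tmb_def Let_def)
  then obtain C where C: "Jac f p = W p ** C" using span_columns_factor by blast
  let ?G = "transpose (W p) ** W p"
  have "det ?G \<noteq> 0" using det_gram_pos[OF tmb_cross_nonzero[OF assms]] by simp
  have "Lam f W p = transpose C ** (?G ** matrix_inv ?G)"
    by (simp add: Lam_def C matrix_transpose_mul matrix_mul_assoc)
  also have "\<dots> = transpose C"
    using \<open>det ?G \<noteq> 0\<close> by (simp add: matrix_inv_cancel)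
  finally have "Lam f W p = transpose C" .
  then show ?thesis by (simp add: C)
qed

lemma det_Lam_nonzero_if_regular:
  assumes "smooth_on U f" "tmb U f W" "p \<in> U - singular_set U f"
  shows "det (Lam f W p) \<noteq> 0"
proof -
  have "linear (frechet_derivative f (at p))"
    using assms(3) by (intro has_derivative_linear[OF smooth_on_derivative(1)[OF assms(1)]]) simp
  then have "frechet_derivative f (at p) v = Jac f p *v v" for v
    by (simp add: jacobian_def matrix_works)
  then have "frechet_derivative f (at p) v = W p *v (transpose (Lam f W p) *v v)" for v
    using tmb_Jac[OF assms(2), of p] assms(3) by (simp only: matrix_vector_mul_assoc Diff_iff)
  moreover have "inj (frechet_derivative f (at p))"
    using assms(3) by (auto simp: singular_set_def)
  ultimately have "inj ((*v) (transpose (Lam f W p)))"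
    unfolding inj_def by metis
  then have "invertible (transpose (Lam f W p))"
    by (simp add: invertible_left_inverse matrix_left_invertible_injective)
  then show ?thesis by (simp add: invertible_det_nz)
qed

definition unit_normal_on :: "(real^2) set \<Rightarrow> (real^2 \<Rightarrow> real^2^3) \<Rightarrow> (real^2 \<Rightarrow> real^3) \<Rightarrow> bool" where
  "unit_normal_on U W n \<longleftrightarrow> smooth_on U n \<and> (\<forall>p\<in>U. norm (n p) = 1 \<and> (\<forall>i. n p \<bullet> column i (W p) = 0))"

lemma unit_normal_induced:
  assumes "open U" "tmb U f W"
  shows "unit_normal_on U W (induced_normal W)"
proof -
  have eq: "induced_normal W = (\<lambda>p. inverse (norm (cross_cols (W p))) *\<^sub>R cross_cols (W p))"
    by (auto simp: induced_normal_def cross_cols_def Let_def)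
  have "smooth_on U W" using assms(2) by (simp add: tmb_def)
  then have N: "smooth_on U (\<lambda>p. cross_cols (W p))"
    unfolding cross_cols_def by (intro smooth_on_cross smooth_on_column assms(1))
  have "smooth_on U (induced_normal W)"
    unfolding eq using tmb_cross_nonzero[OF assms(2)]
    by (intro smooth_on_scaleR smooth_on_inverse smooth_on_norm assms(1) N) auto
  moreover have "norm (induced_normal W p) = 1" if "p \<in> U" for p
    using tmb_cross_nonzero[OF assms(2) that] by (simp add: eq)
  moreover have "induced_normal W p \<bullet> column i (W p) = 0" for p i
    using exhaust_2[of i] by (auto simp: eq cross_cols_def dot_cross_self)
  ultimately show ?thesis by (simp add: unit_normal_on_def)
qed

text \<open>
  In three dimensions the orthogonal complement of the plane spanned by the columns is a line, which
  contains both vectors.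
\<close>

lemma unit_normal_cross_cols:
  assumes "unit_normal_on U W n" "p \<in> U"
  shows "cross_cols (W p) = (n p \<bullet> cross_cols (W p)) *\<^sub>R n p"
  unfolding cross_cols_def
  by (rule cross_parallel_unit_normal) (use assms in \<open>auto simp: unit_normal_on_def\<close>)

lemma unit_normal_orthogonal_derivative:
  assumes "open U" "unit_normal_on U W n" "p \<in> U"
  shows "n p \<bullet> frechet_derivative n (at p) v = 0"
proof -
  have n: "(n has_derivative frechet_derivative n (at p)) (at p)"
    using assms by (intro smooth_on_derivative(1)) (auto simp: unit_normal_on_def)
  have "((\<lambda>q. n q \<bullet> n q) has_derivative
      (\<lambda>v. n p \<bullet> frechet_derivative n (at p) v + frechet_derivative n (at p) v \<bullet> n p)) (at p)"
    by (rule has_derivative_inner[OF n n])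
  moreover have "((\<lambda>q. n q \<bullet> n q) has_derivative (\<lambda>v. 0)) (at p)"
    by (rule has_derivative_transform_within_open[OF has_derivative_const[of 1] \<open>open U\<close> \<open>p \<in> U\<close>])
       (use assms(2) in \<open>simp add: unit_normal_on_def norm_eq_1\<close>)
  ultimately have "(\<lambda>v. n p \<bullet> frechet_derivative n (at p) v + frechet_derivative n (at p) v \<bullet> n p)
      = (\<lambda>v. 0)"
    by (rule has_derivative_unique)
  from fun_cong[OF this, of v] show ?thesis by (simp add: inner_commute)
qed

text \<open>
  The derivatives of a unit field are orthogonal to the field, and the plane orthogonal to \<open>n p\<close> is the
  one spanned by the columns of \<open>W p\<close>.
\<close>

lemma tmb_unit_normal:
  assumes "open U" "tmb U f W" "unit_normal_on U W n"
  shows "tmb U n W"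
proof -
  have "frechet_derivative n (at p) v \<in> span {column 1 (W p), column 2 (W p)}" if "p \<in> U" for p v
  proof (rule orthogonal_cross_in_span)
    show "cross3 (column 1 (W p)) (column 2 (W p)) \<noteq> 0"
      using tmb_cross_nonzero[OF assms(2) that] by (simp add: cross_cols_def)
    have "frechet_derivative n (at p) v \<bullet> cross_cols (W p) = 0"
      using unit_normal_orthogonal_derivative[OF assms(1,3) that, of v]
      by (subst unit_normal_cross_cols[OF assms(3) that]) (simp add: inner_commute)
    then show "frechet_derivative n (at p) v \<bullet> cross3 (column 1 (W p)) (column 2 (W p)) = 0"
      by (simp add: cross_cols_def)
  qed
  then show ?thesis using assms(2) by (simp add: tmb_def Let_def)
qed

lemma frontal_unit_normal:
  assumes "open U" "tmb U f W" "unit_normal_on U W n"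
  shows "frontal U n"
proof -
  have "\<exists>V \<nu>. open V \<and> p \<in> V \<and> V \<subseteq> U \<and> smooth_on V (\<nu> :: real^2 \<Rightarrow> real^3) \<and>
      (\<forall>q\<in>V. norm (\<nu> q) = 1 \<and> orthogonal (\<nu> q) (deriv_u n q) \<and> orthogonal (\<nu> q) (deriv_v n q))"
    if "p \<in> U" for p
    using assms that unit_normal_orthogonal_derivative[OF assms(1,3)]
    by (intro exI[of _ U] exI[of _ n]) (auto simp: unit_normal_on_def orthogonal_def)
  then show ?thesis
    using tmb_unit_normal[OF assms] assms(3) by (auto simp: frontal_def unit_normal_on_def)
qed

text \<open>
  Where \<open>f\<close> is immersive, both unit vectors are parallel to \<open>f\<^sub>u \<times> f\<^sub>v\<close>; the singular points follow by
  density. The coefficient is an inner product rather than a chosen sign because it is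
  smooth by construction.
\<close>

lemma unit_normals_agree_up_to_sign:
  assumes "open U" "smooth_on U f" "interior (singular_set U f) = {}"
    and W: "tmb U f W" "unit_normal_on U W n" and V: "tmb U f V" "unit_normal_on U V m"
    and "p \<in> U"
  shows "n p = (n p \<bullet> m p) *\<^sub>R m p"
proof (rule eq_on_if_eq_off_empty_interior[where p = p, OF assms(1,3)])
  have "continuous_on U n" "continuous_on U m"
    using W V by (auto simp: unit_normal_on_def smooth_on_continuous)
  then show "continuous_on U n" "continuous_on U (\<lambda>p. (n p \<bullet> m p) *\<^sub>R m p)"
    by (auto intro!: continuous_intros)
  fix q assume q: "q \<in> U - singular_set U f"
  have par: "\<exists>c. cross_cols (Jac f q) = c *\<^sub>R k q \<and> c \<noteq> 0 \<and> norm (k q) = 1"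
    if A: "tmb U f A" "unit_normal_on U A k" for A k
  proof -
    have "cross_cols (Jac f q) = det (Lam f A q) *\<^sub>R cross_cols (A q)"
      using tmb_Jac[OF A(1), of q] q by (simp add: cross_cols_mult)
    also have "\<dots> = (det (Lam f A q) * (k q \<bullet> cross_cols (A q))) *\<^sub>R k q"
      using q by (subst unit_normal_cross_cols[OF A(2)]) auto
    finally have "cross_cols (Jac f q) = (det (Lam f A q) * (k q \<bullet> cross_cols (A q))) *\<^sub>R k q" .
    moreover have "k q \<bullet> cross_cols (A q) \<noteq> 0"
      using tmb_cross_nonzero[OF A(1), of q] unit_normal_cross_cols[OF A(2), of q] q by auto
    moreover have "det (Lam f A q) \<noteq> 0" using det_Lam_nonzero_if_regular[OF assms(2) A(1) q] .
    moreover have "norm (k q) = 1" using A(2) q by (simp add: unit_normal_on_def)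
    ultimately show ?thesis by auto
  qed
  obtain c d where c: "cross_cols (Jac f q) = c *\<^sub>R n q" "c \<noteq> 0"
    and d: "cross_cols (Jac f q) = d *\<^sub>R m q" "norm (m q) = 1"
    using par[OF W] par[OF V] by auto
  have "n q = inverse c *\<^sub>R (c *\<^sub>R n q)" using c by simp
  also have "c *\<^sub>R n q = d *\<^sub>R m q" using c(1) d(1) by simp
  also have "inverse c *\<^sub>R (d *\<^sub>R m q) = (inverse c * d) *\<^sub>R m q" by simp
  finally show "n q = (n q \<bullet> m q) *\<^sub>R m q" using d(2) by (simp add: norm_eq_1)
qed fact

text \<open>
  The factor \<open>n \<bullet> m\<close> is continuous with values \<open>1\<close> and \<open>-1\<close>, hence locally constant, and so it does not
  contribute to the derivative.
\<close>

lemma Jac_up_to_sign: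
  assumes "open U" "smooth_on U n" "smooth_on U m"
    and unit: "\<And>q. q \<in> U \<Longrightarrow> norm (n q) = 1 \<and> norm (m q) = 1 \<and> n q = (n q \<bullet> m q) *\<^sub>R m q"
    and "p \<in> U"
  shows "Jac n p = (n p \<bullet> m p) *\<^sub>R Jac m p"
proof -
  let ?s = "\<lambda>q. n q \<bullet> m q"
  have s: "?s q = 1 \<or> ?s q = -1" if "q \<in> U" for q
  proof -
    have "norm (n q) = \<bar>?s q\<bar> * norm (m q)" using unit[OF that] by (metis norm_scaleR)
    then show ?thesis using unit[OF that] by auto
  qed
  have cs: "continuous_on U ?s"
    using assms(2,3) by (intro continuous_intros smooth_on_continuous)
  \<comment> \<open>all values of \<open>?s\<close> are \<open>1\<close> or \<open>-1\<close>, so those closer than 1 to each other are equal\<close>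
  have "open (U \<inter> ?s -` ball (?s p) 1)" (is "open ?N")
    by (rule continuous_open_preimage[OF cs assms(1) open_ball])
  have const: "?s q = ?s p" if "q \<in> ?N" for q
    using s[of q] s[OF \<open>p \<in> U\<close>] that by (auto simp: dist_real_def)
  have "(m has_derivative frechet_derivative m (at p)) (at p)"
    by (rule smooth_on_derivative(1)) fact+
  then have "((\<lambda>q. ?s p *\<^sub>R m q) has_derivative (\<lambda>v. ?s p *\<^sub>R frechet_derivative m (at p) v)) (at p)"
    by (rule has_derivative_scaleR_right)
  then have "(n has_derivative (\<lambda>v. ?s p *\<^sub>R frechet_derivative m (at p) v)) (at p)"
  proof (rule has_derivative_transform_within_open)
    show "open ?N" by fact
    show "p \<in> ?N" using \<open>p \<in> U\<close> by simp
    show "?s p *\<^sub>R m q = n q" if "q \<in> ?N" for q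
      using const[OF that] unit[of q] that by auto
  qed
  from frechet_derivative_at[OF this, symmetric] show ?thesis
    by (simp add: jacobian_def matrix_def vec_eq_iff)
qed

text \<open>
  Differentiating \<open>D\<^sub>i f \<bullet> n = 0\<close> in the direction \<open>j\<close> shows that the entry of \<open>II\<close> at \<open>(i, j)\<close> is
  \<open>D\<^sub>j D\<^sub>i f \<bullet> n\<close>, and second derivatives commute.
\<close>

lemma form_II_symmetric:
  assumes "open U" "smooth_on U f" "tmb U f W" "unit_normal_on U W n" "p \<in> U"
  shows "transpose (form_II f n p) = form_II f n p"
proof -
  let ?e = "\<lambda>i. axis i 1 :: real^2"
  have n: "smooth_on U n" using assms(4) by (simp add: unit_normal_on_def)
  have orth: "frechet_derivative f (at q) (?e i) \<bullet> n q = 0" if "q \<in> U" for q i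
  proof -
    have "frechet_derivative f (at q) (?e i) = W q *v column i (transpose (Lam f W q))"
      unfolding column_Jac[symmetric] tmb_Jac[OF assms(3) that]
      by (simp add: column_def matrix_matrix_mult_def matrix_vector_mult_def vec_eq_iff)
    then show ?thesis
      using assms(4) that
      by (simp add: matrix_vector_mult_columns inner_add_left unit_normal_on_def inner_commute[of _ "n q"]
          inner_add_right)
  qed
  have II: "form_II f n p $ i $ j = frechet_derivative (\<lambda>q. frechet_derivative f (at q) (?e i)) (at p) (?e j) \<bullet> n p"
    for i j
  proof -
    let ?g = "\<lambda>q. frechet_derivative f (at q) (?e i)"
    have g: "(?g has_derivative frechet_derivative ?g (at p)) (at p)"
      by (intro smooth_on_derivative(1)[OF smooth_on_derivative(2)[OF assms(2)] assms(5)])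
    have "((\<lambda>q. ?g q \<bullet> n q) has_derivative
        (\<lambda>v. ?g p \<bullet> frechet_derivative n (at p) v + frechet_derivative ?g (at p) v \<bullet> n p)) (at p)"
      by (rule has_derivative_inner[OF g smooth_on_derivative(1)[OF n assms(5)]])
    moreover have "((\<lambda>q. ?g q \<bullet> n q) has_derivative (\<lambda>v. 0)) (at p)"
      by (rule has_derivative_transform_within_open[OF has_derivative_const[of 0] assms(1,5)]) (simp add: orth)
    ultimately have "(\<lambda>v. ?g p \<bullet> frechet_derivative n (at p) v + frechet_derivative ?g (at p) v \<bullet> n p) = (\<lambda>v. 0)"
      by (rule has_derivative_unique)
    from fun_cong[OF this, of "?e j"]
    have "frechet_derivative ?g (at p) (?e j) \<bullet> n p = - (column i (Jac f p) \<bullet> column j (Jac n p))"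
      by (simp add: column_Jac)
    then show ?thesis
      by (simp add: form_II_def matrix_matrix_mult_def transpose_def column_def inner_vec_def)
  qed
  show ?thesis
    by (simp add: vec_eq_iff transpose_def II mixed_derivatives_commute[OF assms(1,2,5)])
qed

section \<open>The shape matrix\<close>

text \<open>
  With \<open>P = L\<^sup>T W\<^sup>T W\<close> the fundamental forms are \<open>I = P L\<close> and \<open>II = - P S L\<close>, so
  \<open>II I\<^sup>-\<^sup>1 = - P S P\<^sup>-\<^sup>1\<close> is conjugate to \<open>- S\<close>; for matrices of size 2 the sign does not affect the
  determinant.
\<close>

lemma curvatures_of_shape_matrix:
  assumes x: "Jac x p = W ** L" and n: "Jac n p = W ** S ** L"
    and "det L \<noteq> 0" "cross_cols W \<noteq> 0"
  shows "gauss_curvature x n p = det S" and "mean_curvature x n p = - (trace S / 2)"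
proof -
  define P where "P = transpose L ** (transpose W ** W)"
  have I: "form_I x p = P ** L"
    by (simp add: form_I_def x P_def matrix_transpose_mul matrix_mul_assoc)
  have II: "form_II x n p = - (P ** S ** L)"
    by (simp add: form_II_def x n P_def matrix_transpose_mul matrix_mul_assoc)
  have P: "det P \<noteq> 0"
    using assms det_gram_pos[of W] by (simp add: P_def det_mul)
  have "det (- A) = det A" for A :: "real^2^2" by (simp add: det_2)
  then show "gauss_curvature x n p = det S"
    using P assms(3) by (simp add: gauss_curvature_def I II det_mul)
  have "(P ** L) ** (matrix_inv L ** matrix_inv P) = P ** (L ** matrix_inv L) ** matrix_inv P"
    by (simp only: matrix_mul_assoc)
  then have inv: "matrix_inv (P ** L) = matrix_inv L ** matrix_inv P"
    using P assms(3) by (intro matrix_inv_eqI) (simp add: matrix_inv_cancel)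
  have "form_II x n p ** matrix_inv (form_I x p) = - (P ** S ** (L ** matrix_inv L) ** matrix_inv P)"
    unfolding I II inv by (simp add: matrix_mul_assoc matrix_mult_minus_left)
  then have "trace (form_II x n p ** matrix_inv (form_I x p)) = - trace (P ** S ** matrix_inv P)"
    using assms(3) by (simp add: matrix_inv_cancel trace_def sum_negf)
  also have "trace (P ** S ** matrix_inv P) = trace ((matrix_inv P ** P) ** S)"
    by (simp add: trace_mul_sym[of "P ** S"] matrix_mul_assoc)
  finally show "mean_curvature x n p = - (trace S / 2)"
    using P by (simp add: mean_curvature_def matrix_inv_cancel)
qed

lemma normal_curvature_of_shape_matrix:
  assumes x: "Jac x p = W ** L" and n: "Jac n p = W ** S ** L" and "det L \<noteq> 0"
  shows "normal_curvature x n p (matrix_inv L *v \<omega>) =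
    - (\<omega> \<bullet> ((transpose W ** W ** S) *v \<omega>)) / (\<omega> \<bullet> ((transpose W ** W) *v \<omega>))"
proof -
  have L: "L *v (matrix_inv L *v \<omega>) = \<omega>"
    using assms(3) by (simp add: matrix_vector_mul_assoc matrix_inv_cancel)
  have pull: "\<zeta> \<bullet> ((transpose L ** A ** L) *v \<zeta>) = (L *v \<zeta>) \<bullet> (A *v (L *v \<zeta>))" for A \<zeta>
    by (simp only: matrix_vector_mul_assoc[symmetric] inner_transpose_mult)
  have "form_I x p = transpose L ** (transpose W ** W) ** L"
    by (simp add: form_I_def x matrix_transpose_mul matrix_mul_assoc)
  moreover have "form_II x n p = - (transpose L ** (transpose W ** W ** S) ** L)"
    by (simp add: form_II_def x n matrix_transpose_mul matrix_mul_assoc)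
  moreover have "(- A) *v v = - (A *v v)" for A :: "real^2^2" and v
    by (simp add: matrix_vector_mult_def vec_eq_iff sum_negf)
  ultimately show ?thesis
    by (simp add: normal_curvature_def pull L)
qed

text \<open>
  Where \<open>x\<close> is immersive, the equation determines \<open>S\<close>. With \<open>G = W\<^sup>T W\<close> the matrix \<open>G S\<close> is symmetric
  and its quadratic form is \<open>\<omega> \<bullet> G S \<omega> = - F(p, \<omega>) (\<omega> \<bullet> G \<omega>)\<close>. Polarizing the right-hand side
  yields a matrix \<open>N\<close> that is defined and smooth on all of \<open>U\<close>, and \<open>G\<^sup>-\<^sup>1 N\<close> is the desired field.
\<close>

lemma shape_matrix_extension:
  assumes U: "open U" and x: "smooth_on U x" "interior (singular_set U x) = {}" "tmb U x W"
    and n: "unit_normal_on U W n"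
    and F: "smooth_on (U \<times> (UNIV - {0})) F"
    and ext: "\<And>p \<omega>. p \<in> U - singular_set U x \<Longrightarrow> \<omega> \<noteq> 0 \<Longrightarrow>
      F (p, \<omega>) = normal_curvature x n p (transpose (matrix_inv (Lam x W p)) *v \<omega>)"
  obtains S where "smooth_on U S"
    "\<And>p. p \<in> U \<Longrightarrow> transpose (Lam n W p) = S p ** transpose (Lam x W p)"
proof -
  define G where "G = (\<lambda>p. transpose (W p) ** W p)"
  define q where "q = (\<lambda>\<omega> p. - (F (p, \<omega>) * (\<omega> \<bullet> (G p *v \<omega>))))"
  define N :: "real^2 \<Rightarrow> real^2^2" where
    "N = (\<lambda>p. \<chi> i j. (q (axis i 1 + axis j 1) p - q (axis i 1) p - q (axis j 1) p) / 2)"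
  define S where "S = (\<lambda>p. matrix_inv (G p) ** N p)"
  have W: "smooth_on U W" using x(3) by (simp add: tmb_def)
  have G: "smooth_on U G"
    unfolding G_def by (intro smooth_on_matrix_mult smooth_on_transpose U W)
  have detG: "det (G p) \<noteq> 0" if "p \<in> U" for p
    using det_gram_pos[OF tmb_cross_nonzero[OF x(3) that]] by (simp add: G_def)
  have q: "smooth_on U (q \<omega>)" if "\<omega> \<noteq> 0" for \<omega>
  proof -
    have "linear (\<lambda>A :: real^2^2. \<omega> \<bullet> (A *v \<omega>))"
      by (intro linearI) (simp_all add: matrix_vector_mult_add_rdistrib inner_add_right
          scaleR_matrix_vector_assoc[symmetric])
    then have "smooth_on U (\<lambda>p. \<omega> \<bullet> (G p *v \<omega>))"
      by (intro smooth_on_bounded_linear[of "\<lambda>A. \<omega> \<bullet> (A *v \<omega>)"] U G)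
         (simp add: linear_conv_bounded_linear)
    then show ?thesis
      unfolding q_def using that
      by (intro smooth_on_minus smooth_on_mult smooth_on_slice[OF U F] U) auto
  qed
  have nz: "axis i 1 \<noteq> (0 :: real^2)" "axis i 1 + axis j 1 \<noteq> (0 :: real^2)" for i j
    by (auto simp: vec_eq_iff axis_def intro!: exI[of _ i])
  have "smooth_on U (\<lambda>p. (1 / 2) * (q (axis i 1 + axis j 1) p - q (axis i 1) p - q (axis j 1) p))" for i j
    by (intro smooth_on_mult smooth_on_diff smooth_on_const q nz U)
  then have "smooth_on U N"
    by (intro smooth_on_matrix[OF U]) (simp add: N_def)
  then have S: "smooth_on U S"
    unfolding S_def using detG
    by (intro smooth_on_matrix_mult smooth_on_matrix_inv_2 U G)
  have Lam: "smooth_on U (\<lambda>p. transpose (Lam f W p))" if f: "smooth_on U f" for f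
  proof -
    have "smooth_on U (\<lambda>p. Jac f p $ i $ j)" for i j
      using smooth_on_nth[OF U smooth_on_derivative(2)[OF f]]
      by (simp add: jacobian_def matrix_def)
    then have "smooth_on U (Jac f)" by (rule smooth_on_matrix[OF U])
    then show ?thesis
      unfolding Lam_def using detG unfolding G_def
      by (intro smooth_on_matrix_mult smooth_on_transpose smooth_on_matrix_inv_2 U W)
  qed
  have tmb_n: "tmb U n W" by (rule tmb_unit_normal[OF U x(3) n])
  have "transpose (Lam n W p) = S p ** transpose (Lam x W p)" if "p \<in> U" for p
  proof (rule eq_on_if_eq_off_empty_interior[OF U x(2) _ _ _ that])
    show "continuous_on U (\<lambda>p. transpose (Lam n W p))"
      by (intro smooth_on_continuous Lam) (use n in \<open>simp add: unit_normal_on_def\<close>)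
    show "continuous_on U (\<lambda>p. S p ** transpose (Lam x W p))"
      by (intro smooth_on_continuous smooth_on_matrix_mult Lam S U x)
    fix r assume r: "r \<in> U - singular_set U x"
    then have "r \<in> U" by simp
    define L where "L = transpose (Lam x W r)"
    define T where "T = transpose (Lam n W r) ** matrix_inv L"
    have detL: "det L \<noteq> 0" using det_Lam_nonzero_if_regular[OF x(1,3) r] by (simp add: L_def)
    have TL: "T ** L = transpose (Lam n W r)"
      using detL by (simp add: T_def matrix_mul_assoc[symmetric] matrix_inv_cancel)
    have Jx: "Jac x r = W r ** L" using tmb_Jac[OF x(3) \<open>r \<in> U\<close>] by (simp add: L_def)
    have Jn: "Jac n r = W r ** T ** L"
      using tmb_Jac[OF tmb_n \<open>r \<in> U\<close>] by (simp add: TL matrix_mul_assoc[symmetric])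
    have "L ** matrix_inv L = mat 1" using detL by (simp add: matrix_inv_cancel)
    then have "transpose (matrix_inv L) ** transpose L = mat 1"
      by (metis matrix_transpose_mul transpose_mat)
    then have "transpose L ** transpose (matrix_inv L) = mat 1"
      by (simp add: matrix_left_right_inverse)
    then have inv: "transpose (matrix_inv (Lam x W r)) = matrix_inv L"
      using matrix_inv_eqI[of "transpose L"] by (simp add: L_def)
    have qf: "\<omega> \<bullet> ((G r ** T) *v \<omega>) = q \<omega> r" if "\<omega> \<noteq> 0" for \<omega>
      using ext[OF r that] gram_form_pos[OF tmb_cross_nonzero[OF x(3) \<open>r \<in> U\<close>] that]
      by (simp add: q_def inv normal_curvature_of_shape_matrix[OF Jx Jn detL] G_def)
    have II: "form_II x n r = - (transpose L ** (G r ** T) ** L)"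
      by (simp add: form_II_def Jx Jn G_def matrix_transpose_mul matrix_mul_assoc)
    have "transpose L ** (G r ** T) ** L = transpose (transpose L ** (G r ** T) ** L)"
      using form_II_symmetric[OF U x(1,3) n \<open>r \<in> U\<close>] unfolding II by (simp add: transpose_def vec_eq_iff)
    also have "\<dots> = transpose L ** transpose (G r ** T) ** L"
      by (simp add: matrix_transpose_mul matrix_mul_assoc)
    finally have eq: "transpose L ** (G r ** T) ** L = transpose L ** transpose (G r ** T) ** L" .
    \<comment> \<open>cancelling the invertible outer factors in \<open>eq\<close> leaves the symmetry of \<open>G T\<close>\<close>
    have "transpose (matrix_inv L) ** (transpose L ** A ** L) ** matrix_inv L =
        (transpose (matrix_inv L) ** transpose L) ** A ** (L ** matrix_inv L)" for A
      by (simp only: matrix_mul_assoc)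
    then have "transpose (matrix_inv L) ** (transpose L ** A ** L) ** matrix_inv L = A" for A
      by (simp add: \<open>L ** matrix_inv L = mat 1\<close> \<open>transpose (matrix_inv L) ** transpose L = mat 1\<close>)
    then have "transpose (G r ** T) = G r ** T" using eq by metis
    from symmetric_matrix_polarization[OF this] have "G r ** T = N r"
      unfolding qf[OF nz(1)] qf[OF nz(2)] by (simp add: vec_eq_iff N_def)
    then have "S r = (matrix_inv (G r) ** G r) ** T" by (metis S_def matrix_mul_assoc)
    then have "S r = T" using detG[OF \<open>r \<in> U\<close>] by (simp add: matrix_inv_cancel)
    then show "transpose (Lam n W r) = S r ** transpose (Lam x W r)"
      using TL by (simp add: L_def)
  qed
  then show ?thesis using that S by blast
qed

text \<open>
  The basis \<open>V\<close> comes from the extension of the normal curvature and is unrelated to the basis \<open>W\<close> that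
  induces \<open>n\<close>. Keeping \<open>V\<close> and changing its normal to \<open>n\<close> replaces \<open>S\<close> by \<open>\<plusminus>S\<close>, which is
  easier than transporting the extension to \<open>W\<close>.
\<close>

lemma shape_matrix_exists:
  assumes U: "open U" and x: "proper_frontal U x" "extendable_normal_curvature U x"
    and W: "tmb U x W" and n: "unit_normal_on U W n"
  obtains V S where "tmb U x V" "unit_normal_on U V n" "smooth_on U S"
    "\<And>p. p \<in> U \<Longrightarrow> transpose (Lam n V p) = S p ** transpose (Lam x V p)"
proof -
  have x': "smooth_on U x" "interior (singular_set U x) = {}"
    using x(1) by (simp_all add: proper_frontal_def frontal_def)
  obtain V F where V: "tmb U x V" and F: "smooth_on (U \<times> (UNIV - {0})) F"
    and ext: "\<forall>p \<in> U - singular_set U x. \<forall>\<omega>. \<omega> \<noteq> 0 \<longrightarrow>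
      F (p, \<omega>) = normal_curvature x (induced_normal V) p (transpose (matrix_inv (Lam x V p)) *v \<omega>)"
    using x(2) unfolding extendable_normal_curvature_def by blast
  define m where "m = induced_normal V"
  have m: "unit_normal_on U V m" unfolding m_def by (rule unit_normal_induced[OF U V])
  obtain S where S: "smooth_on U S"
    "\<And>p. p \<in> U \<Longrightarrow> transpose (Lam m V p) = S p ** transpose (Lam x V p)"
    by (rule shape_matrix_extension[OF U x' V m F]) (use ext in \<open>auto simp: m_def\<close>)
  let ?s = "\<lambda>p. n p \<bullet> m p"
  have smooth: "smooth_on U n" "smooth_on U m" using n m by (auto simp: unit_normal_on_def)
  have sign: "n p = ?s p *\<^sub>R m p" if "p \<in> U" for p
    by (rule unit_normals_agree_up_to_sign[OF U x' W n V m that])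
  have "n p \<bullet> column i (V p) = 0" if "p \<in> U" for p i
    using sign[OF that] m that by (metis inner_scaleR_left mult_zero_right unit_normal_on_def)
  then have "unit_normal_on U V n" using n by (auto simp: unit_normal_on_def)
  moreover have "transpose (Lam n V p) = (?s p *\<^sub>R S p) ** transpose (Lam x V p)" if "p \<in> U" for p
  proof -
    have "Jac n p = ?s p *\<^sub>R Jac m p"
      by (rule Jac_up_to_sign[OF U smooth _ that]) (use n m sign in \<open>auto simp: unit_normal_on_def\<close>)
    then have "transpose (Lam n V p) = ?s p *\<^sub>R transpose (Lam m V p)"
      by (simp add: Lam_def transpose_scalar flip: scalar_matrix_assoc)
    then show ?thesis by (simp add: S(2)[OF that] flip: scalar_matrix_assoc)
  qed
  moreover have "smooth_on U (\<lambda>p. ?s p *\<^sub>R S p)"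
    by (intro smooth_on_scaleR smooth_on_inner smooth S U)
  ultimately show ?thesis using that V by blast
qed

section \<open>Curvatures of frontals with extendable normal curvature\<close>

theorem corollary3p1:
  fixes U :: "(real^2) set"
    and x n :: "real^2 \<Rightarrow> real^3"
    and \<Omega> :: "real^2 \<Rightarrow> real^2^3"
  assumes "open U"
    and "proper_frontal U x"
    and "extendable_normal_curvature U x"
    and "tmb U x \<Omega>"
    and "n = induced_normal \<Omega>"
  shows "(\<exists>K. smooth_extension U (U - singular_set U x) (gauss_curvature x n) K) \<and>
         (\<exists>H. smooth_extension U (U - singular_set U x) (mean_curvature x n) H) \<and>
         (\<forall>K. smooth_extension U (U - singular_set U x) (gauss_curvature x n) K \<longrightarrow>
              ((\<forall>p\<in>U. K p \<noteq> 0) \<longleftrightarrow> frontal_sim U x n))"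
proof -
  note U = \<open>open U\<close>
  have x: "frontal U x" "smooth_on U x" "interior (singular_set U x) = {}"
    using assms(2) by (simp_all add: proper_frontal_def frontal_def)
  have n: "unit_normal_on U \<Omega> n"
    unfolding assms(5) by (rule unit_normal_induced[OF U assms(4)])
  obtain V S where V: "tmb U x V" "unit_normal_on U V n" and S: "smooth_on U S"
    and weingarten: "\<And>p. p \<in> U \<Longrightarrow> transpose (Lam n V p) = S p ** transpose (Lam x V p)"
    using shape_matrix_exists[OF assms(1-4) n] by metis
  have tmb_n: "tmb U n V" by (rule tmb_unit_normal[OF U V])
  have Jx: "Jac x p = V p ** transpose (Lam x V p)"
    and Jn: "Jac n p = V p ** S p ** transpose (Lam x V p)" if "p \<in> U" for p
    using tmb_Jac[OF V(1) that] tmb_Jac[OF tmb_n that]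
    by (simp_all add: weingarten[OF that] matrix_mul_assoc)
  have curv: "gauss_curvature x n p = det (S p)" "mean_curvature x n p = - (trace (S p) / 2)"
    if p: "p \<in> U - singular_set U x" for p
  proof -
    have "det (transpose (Lam x V p)) \<noteq> 0" using det_Lam_nonzero_if_regular[OF x(2) V(1) p] by simp
    note C = curvatures_of_shape_matrix[OF Jx Jn this tmb_cross_nonzero[OF V(1)]]
    show "gauss_curvature x n p = det (S p)" "mean_curvature x n p = - (trace (S p) / 2)"
      using C p by blast+
  qed
  have detS: "smooth_on U (\<lambda>p. det (S p))" by (rule smooth_on_det_2[OF U S])
  have K: "smooth_extension U (U - singular_set U x) (gauss_curvature x n) (\<lambda>p. det (S p))"
    using detS curv by (simp add: smooth_extension_def)
  have "smooth_on U (\<lambda>p. (- 1 / 2) * (S p $ 1 $ 1 + S p $ 2 $ 2))"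
    by (intro smooth_on_mult smooth_on_const smooth_on_add smooth_on_nth U S)
  then have H: "smooth_extension U (U - singular_set U x) (mean_curvature x n) (\<lambda>p. - (trace (S p) / 2))"
    using curv by (simp add: smooth_extension_def trace_def sum_2)
  have "(\<forall>p\<in>U. k p \<noteq> 0) \<longleftrightarrow> frontal_sim U x n"
    if k: "smooth_extension U (U - singular_set U x) (gauss_curvature x n) k" for k
  proof -
    have ck: "continuous_on U k" using k by (simp add: smooth_extension_def smooth_on_continuous)
    have k_det: "k p = det (S p)" if "p \<in> U" for p
      by (rule eq_on_if_eq_off_empty_interior[OF U x(3) ck smooth_on_continuous[OF detS] _ that])
         (use k curv in \<open>simp add: smooth_extension_def\<close>)
    show ?thesis
    proof
      assume nz: "\<forall>p\<in>U. k p \<noteq> 0"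
      have "invertible (transpose (S p)) \<and> Lam n V p = Lam x V p ** transpose (S p)" if "p \<in> U" for p
      proof
        have "det (S p) \<noteq> 0" using nz k_det[OF that] that by metis
        then show "invertible (transpose (S p))" by (simp add: invertible_det_nz)
        show "Lam n V p = Lam x V p ** transpose (S p)"
          using arg_cong[OF weingarten[OF that], of transpose] by (simp add: matrix_transpose_mul)
      qed
      then show "frontal_sim U x n"
        unfolding frontal_sim_def
        using x(1) frontal_unit_normal[OF U V] V(1) tmb_n smooth_on_transpose[OF U S] by blast
    next
      assume "frontal_sim U x n"
      then obtain W1 W2 B where W: "tmb U x W1" "tmb U n W2" and B: "smooth_on U B"
        and LB: "\<And>p. p \<in> U \<Longrightarrow> invertible (B p) \<and> Lam n W2 p = Lam x W1 p ** B p"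
        unfolding frontal_sim_def by blast
      have smooth_cross: "smooth_on U (\<lambda>p. cross_cols (W p))" if "tmb U f W" for f W
        unfolding cross_cols_def using that
        by (intro smooth_on_cross smooth_on_column U) (simp_all add: tmb_def)
      have "k p *\<^sub>R cross_cols (W1 p) = det (B p) *\<^sub>R cross_cols (W2 p)" if "p \<in> U" for p
      proof (rule eq_on_if_eq_off_empty_interior[OF U x(3) _ _ _ that])
        show "continuous_on U (\<lambda>p. k p *\<^sub>R cross_cols (W1 p))"
          by (intro continuous_on_scaleR ck smooth_on_continuous smooth_cross[OF W(1)])
        show "continuous_on U (\<lambda>p. det (B p) *\<^sub>R cross_cols (W2 p))"
          by (intro continuous_on_scaleR smooth_on_continuous smooth_on_det_2 U B smooth_cross[OF W(2)])
        fix q assume q: "q \<in> U - singular_set U x"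
        then have "q \<in> U" by simp
        \<comment> \<open>both sides, scaled by \<open>det \<Lambda>1\<close>, are \<open>n\<^sub>u \<times> n\<^sub>v\<close>\<close>
        have "det (Lam x W1 q) *\<^sub>R (k q *\<^sub>R cross_cols (W1 q)) = k q *\<^sub>R cross_cols (Jac x q)"
          by (simp add: tmb_Jac[OF W(1) \<open>q \<in> U\<close>] cross_cols_mult)
        also have "\<dots> = cross_cols (Jac n q)"
          by (simp add: Jx[OF \<open>q \<in> U\<close>] Jn[OF \<open>q \<in> U\<close>] k_det[OF \<open>q \<in> U\<close>] cross_cols_mult)
        also have "\<dots> = det (Lam x W1 q) *\<^sub>R (det (B q) *\<^sub>R cross_cols (W2 q))"
          using LB[OF \<open>q \<in> U\<close>] by (simp add: tmb_Jac[OF W(2) \<open>q \<in> U\<close>] cross_cols_mult det_mul)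
        finally show "k q *\<^sub>R cross_cols (W1 q) = det (B q) *\<^sub>R cross_cols (W2 q)"
          by (rule scaleR_left_imp_eq[OF det_Lam_nonzero_if_regular[OF x(2) W(1) q]])
      qed
      moreover have "det (B p) *\<^sub>R cross_cols (W2 p) \<noteq> 0" if "p \<in> U" for p
        using LB[OF that] tmb_cross_nonzero[OF W(2) that] by (simp add: invertible_det_nz)
      ultimately show "\<forall>p\<in>U. k p \<noteq> 0" by (metis scaleR_zero_left)
    qed
  qed
  then show ?thesis using K H by blast
qed

end
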